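(* Let $m\ge 2$ be an integer, let $X$ be a real Hilbert space, and let $R\colon X\to X$ be a linear isometry with $R^m=I_X$. Put $A:=\frac1m\sum_{i=1}^m R^i$, $Y:=\{y\in X: Ay=0\}$ and $S:=R-I_X$. Let $C$ be a nonempty closed convex subset of $X$ with support function $\sigma_C$, and let $D:=\{y\in Y:\ \sigma_C(y)+\frac12\|y\|^2\le 0\}$. Then there exist $d,e\in Y$ such that $$\sigma_C(Se)+\langle Sx-Se,e\rangle-\sigma_C(Sx)\le 0\quad\text{for all }x\in X,$$ and $$d=Se\in D.$$
   Context: All spaces are real. $I_X$ is the identity on $X$. The support function of $C$ is $\sigma_C(t):=\sup_{c\in C}\langle c,t\rangle\in(-\infty,+\infty]$. Note that $\sigma_C(Se)$ is finite when $Se\in D$; an inequality $a-\sigma_C(Sx)\le0$ with $a$ real is regarded as true when $\sigma_C(Sx)=+\infty$. *)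

theory Defs
  imports "HOL-Analysis.Analysis"
begin

definition linear_isometry :: "('a::real_normed_vector \<Rightarrow> 'b::real_normed_vector) \<Rightarrow> bool" where
  "linear_isometry R \<longleftrightarrow> linear R \<and> (\<forall>x. norm (R x) = norm x)"

(* For nonempty C the value is never -\<infinity>. In ereal, a - \<infinity> = -\<infinity> for real a, so
   a - support_fun C t \<le> 0 holds whenever support_fun C t = \<infinity>. *)
definition support_fun :: "'a::real_inner set \<Rightarrow> 'a \<Rightarrow> ereal" where
  "support_fun C t = (SUP c\<in>C. ereal (inner c t))"

definition cycle_avg :: "nat \<Rightarrow> ('a::real_vector \<Rightarrow> 'a) \<Rightarrow> 'a \<Rightarrow> 'a" where
  "cycle_avg m R x = (1 / real m) *\<^sub>R (\<Sum>i=1..m. (R ^^ i) x)"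

definition cycle_Y :: "nat \<Rightarrow> ('a::real_vector \<Rightarrow> 'a) \<Rightarrow> 'a set" where
  "cycle_Y m R = {y. cycle_avg m R y = 0}"

definition cycle_S :: "('a::real_vector \<Rightarrow> 'a) \<Rightarrow> 'a \<Rightarrow> 'a" where
  "cycle_S R x = R x - x"

definition cycle_D :: "nat \<Rightarrow> ('a::real_inner \<Rightarrow> 'a) \<Rightarrow> 'a set \<Rightarrow> 'a set" where
  "cycle_D m R C = {y \<in> cycle_Y m R. support_fun C y + ereal (1 / 2 * (norm y)\<^sup>2) \<le> 0}"

end

theory Submission
  imports Defs
begin

text \<open>
  The inclusion defining \<open>e\<close> is dualised. Let \<open>K\<close> be the closure of the projection of \<open>C\<close> onto \<open>Y\<close>
  along the fixed space of \<open>R\<close>; on \<open>Y\<close>, \<open>C\<close> and \<open>K\<close> have the same support function. The claim says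
  that \<open>e\<close> is a subgradient at \<open>S e\<close> of this function, i.e. that \<open>e \<in> K\<close> and
  \<open>\<langle>S e, k - e\<rangle> \<le> 0\<close> for all \<open>k \<in> K\<close>. Equivalently, \<open>e\<close> is a fixed point of
  \<open>x \<mapsto> proj\<^sub>K ((x + R x) / 2)\<close>. As \<open>\<parallel>(u + R u) / 2\<parallel>\<^sup>2 = \<parallel>u\<parallel>\<^sup>2 - \<parallel>S u\<parallel>\<^sup>2 / 4\<close> and
  \<open>\<parallel>u\<parallel> \<le> m \<parallel>S u\<parallel>\<close> on \<open>Y\<close>, this map is a contraction of \<open>K\<close>. Membership of \<open>S e\<close> in \<open>D\<close> follows
  from \<open>\<sigma>\<^sub>C (S e) = \<langle>S e, e\<rangle> = - \<parallel>S e\<parallel>\<^sup>2 / 2\<close>.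
\<close>

section \<open>Metric projection onto a closed convex set in a Hilbert space\<close>

lemma closest_point_exists_Hilbert:
  fixes S :: "'a::{real_inner,complete_space} set"
  assumes "closed S" "convex S" "S \<noteq> {}"
  obtains p where "p \<in> S" "\<And>y. y \<in> S \<Longrightarrow> dist z p \<le> dist z y"
proof -
  define \<delta> where "\<delta> = infdist z S"
  \<comment> \<open>The \<open>T n\<close> are sets of near-minimisers of the distance to
    \<open>z\<close>. They are nested, closed and nonempty with diameters tending to 0, so
    completeness yields a common point, which is a minimiser.\<close>
  define T where "T n = S \<inter> cball z (\<delta> + inverse (real (Suc n)))" for n
  have \<delta>0: "0 \<le> \<delta>"
    by (simp add: \<delta>_def infdist_nonneg)
  have \<delta>_le: "\<delta> \<le> dist z x" if "x \<in> S" for x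
    using that by (simp add: \<delta>_def infdist_le)
  have diam: "(dist x y)\<^sup>2 \<le> 4 * ((\<delta> + r)\<^sup>2 - \<delta>\<^sup>2)"
    if "x \<in> S" "y \<in> S" "dist z x \<le> \<delta> + r" "dist z y \<le> \<delta> + r" for x y r
  proof -
    define w where "w = (1/2) *\<^sub>R x + (1/2) *\<^sub>R y"
    have "w \<in> S"
      unfolding w_def using that(1,2) by (intro convexD[OF assms(2)]) auto
    \<comment> \<open>Parallelogram law for \<open>z - x\<close> and \<open>z - y\<close>; convexity
      keeps the midpoint \<open>w\<close> in \<open>S\<close>, hence at distance at least \<delta>
      from \<open>z\<close>.\<close>
    have "(dist x y)\<^sup>2 = 2 * (dist z x)\<^sup>2 + 2 * (dist z y)\<^sup>2 - 4 * (dist z w)\<^sup>2"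
      by (simp add: w_def dist_norm power2_norm_eq_inner inner_diff inner_add inner_commute
          algebra_simps)
    moreover have "\<delta>\<^sup>2 \<le> (dist z w)\<^sup>2"
      using \<delta>_le[OF \<open>w \<in> S\<close>] \<delta>0 by (simp add: power_mono)
    moreover have "(dist z x)\<^sup>2 \<le> (\<delta> + r)\<^sup>2" "(dist z y)\<^sup>2 \<le> (\<delta> + r)\<^sup>2"
      using that(3,4) by (simp_all add: power_mono)
    ultimately show ?thesis
      by argo
  qed
  have "closed (T n)" for n
    by (simp add: T_def assms(1) closed_Int)
  moreover have "T n \<noteq> {}" for n
  proof -
    have "(INF a\<in>S. dist z a) < \<delta> + inverse (real (Suc n))"
      using infdist_notempty[OF assms(3), of z] by (simp add: \<delta>_def)
    then obtain a where "a \<in> S" "dist z a < \<delta> + inverse (real (Suc n))"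
      by (subst (asm) cINF_less_iff) (auto simp: assms(3) intro: bdd_belowI[of _ 0])
    then show ?thesis
      by (auto simp: T_def)
  qed
  moreover have "T n \<subseteq> T k" if "k \<le> n" for k n
  proof -
    have "inverse (real (Suc n)) \<le> inverse (real (Suc k))"
      using that by (intro le_imp_inverse_le) auto
    then show ?thesis
      unfolding T_def by (intro Int_mono subset_cball add_left_mono order_refl)
  qed
  moreover have "\<exists>n. \<forall>x\<in>T n. \<forall>y\<in>T n. dist x y < \<epsilon>" if "\<epsilon> > 0" for \<epsilon>
  proof -
    have "(\<lambda>n. 4 * ((\<delta> + inverse (real (Suc n)))\<^sup>2 - \<delta>\<^sup>2)) \<longlonglongrightarrow> 4 * ((\<delta> + 0)\<^sup>2 - \<delta>\<^sup>2)"
      by (intro tendsto_intros LIMSEQ_inverse_real_of_nat)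
    then have "\<forall>\<^sub>F n in sequentially. 4 * ((\<delta> + inverse (real (Suc n)))\<^sup>2 - \<delta>\<^sup>2) < \<epsilon>\<^sup>2"
      using that by (intro order_tendstoD(2)) auto
    then obtain n where n: "4 * ((\<delta> + inverse (real (Suc n)))\<^sup>2 - \<delta>\<^sup>2) < \<epsilon>\<^sup>2"
      by (auto simp: eventually_sequentially)
    have "dist x y < \<epsilon>" if "x \<in> T n" "y \<in> T n" for x y
    proof (rule power2_less_imp_less)
      show "(dist x y)\<^sup>2 < \<epsilon>\<^sup>2"
        using diam[of x y "inverse (real (Suc n))"] that n by (simp add: T_def)
    qed (use \<open>\<epsilon> > 0\<close> in simp)
    then show ?thesis
      by blast
  qed
  ultimately obtain p where p: "\<And>n. p \<in> T n"
    using decreasing_closed_nest[of T] by metis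
  have "dist z p \<le> \<delta>"
  proof (rule LIMSEQ_le_const)
    have "(\<lambda>n. \<delta> + inverse (real (Suc n))) \<longlonglongrightarrow> \<delta> + 0"
      by (intro tendsto_intros LIMSEQ_inverse_real_of_nat)
    then show "(\<lambda>n. \<delta> + inverse (real (Suc n))) \<longlonglongrightarrow> \<delta>"
      by simp
    show "\<exists>N. \<forall>n\<ge>N. dist z p \<le> \<delta> + inverse (real (Suc n))"
      using p by (auto simp: T_def)
  qed
  then show thesis
    using that p[of 0] \<delta>_le by (force simp: T_def)
qed

lemma projection_exists_Hilbert:
  fixes S :: "'a::{real_inner,complete_space} set"
  assumes "closed S" "convex S" "S \<noteq> {}"
  obtains P where "\<And>z. P z \<in> S" "\<And>z y. y \<in> S \<Longrightarrow> inner (z - P z) (y - P z) \<le> 0"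
    "\<And>z w. norm (P z - P w) \<le> norm (z - w)"
proof -
  have "\<exists>p\<in>S. \<forall>y\<in>S. inner (z - p) (y - p) \<le> 0" for z
  proof -
    obtain p where "p \<in> S" "\<And>y. y \<in> S \<Longrightarrow> dist z p \<le> dist z y"
      using closest_point_exists_Hilbert[OF assms] by blast
    then show ?thesis
      using any_closest_point_dot[OF assms(2,1)] by blast
  qed
  then obtain P where P: "\<And>z. P z \<in> S" "\<And>z y. y \<in> S \<Longrightarrow> inner (z - P z) (y - P z) \<le> 0"
    by metis
  \<comment> \<open>With \<open>u = z - w\<close> and \<open>v = P z - P w\<close>, adding the two
    obtuse-angle inequalities gives \<open>inner v v \<le> inner u v\<close>; combine this with
    \<open>0 \<le> inner (u - v) (u - v)\<close>.\<close>
  have "norm (P z - P w) \<le> norm (z - w)" for z w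
    using P(2)[OF P(1), of z w] P(2)[OF P(1), of w z]
      inner_ge_zero[of "(z - P z) - (w - P w)"]
    unfolding norm_le by (simp add: inner_add inner_diff inner_commute)
  with P show thesis
    using that by blast
qed

section \<open>Averages and displacements of a periodic linear isometry\<close>

locale periodic_isometry =
  fixes m :: nat and R :: "'a::real_inner \<Rightarrow> 'a"
  assumes m_pos: "m > 0" and isometry: "linear_isometry R" and period: "R ^^ m = id"
begin

abbreviation "A \<equiv> cycle_avg m R"
abbreviation "S \<equiv> cycle_S R"
abbreviation "Y \<equiv> cycle_Y m R"

lemma linear_R: "linear R" and norm_R: "norm (R x) = norm x"
  using isometry by (auto simp: linear_isometry_def)

lemma inner_R: "inner (R x) (R y) = inner x y"
  using isometry unfolding linear_isometry_def
  by (metis orthogonal_transformation orthogonal_transformation_def)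

lemma linear_funpow: "linear (R ^^ i)"
proof (induction i)
  case (Suc i)
  show ?case
    unfolding funpow.simps by (rule linear_compose[OF Suc linear_R])
qed (simp add: linear_ident id_def)

lemma norm_funpow: "norm ((R ^^ i) x) = norm x"
  by (induction i) (simp_all add: norm_R)

lemma linear_A: "linear A"
  unfolding cycle_avg_def
  by (rule linearI) (simp_all add: linear_add[OF linear_funpow] linear_scale[OF linear_funpow]
      sum.distrib scaleR_right.sum scaleR_add_right mult.commute)

lemma bounded_linear_A: "bounded_linear A"
proof (rule bounded_linear_intro)
  show "norm (A x) \<le> norm x * 1" for x
  proof -
    have "norm (\<Sum>i=1..m. (R ^^ i) x) \<le> (\<Sum>i=1..m. norm x)"
      by (rule order_trans[OF norm_sum]) (simp add: norm_funpow)
    then show ?thesis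
      using m_pos by (simp add: cycle_avg_def field_simps)
  qed
qed (simp_all add: linear_add[OF linear_A] linear_scale[OF linear_A])

text \<open>The difference of the two sums telescopes, and its end terms cancel by periodicity. This
  makes \<open>A\<close> invariant under composition with \<open>R\<close> on either side.\<close>

lemma sum_funpow_shift: "(\<Sum>i=1..m. (R ^^ Suc i) x) = (\<Sum>i=1..m. (R ^^ i) x)"
proof -
  have "(\<Sum>i=1..m. (R ^^ Suc i) x - (R ^^ i) x) = (R ^^ Suc m) x - (R ^^ 1) x"
    by (rule sum_Suc_diff) simp
  also have "\<dots> = 0"
    using period by simp
  finally show ?thesis
    by (simp add: sum_subtractf)
qed

lemma R_A: "R (A x) = A x"
proof -
  have "R (A x) = (1 / real m) *\<^sub>R (\<Sum>i=1..m. (R ^^ Suc i) x)"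
    by (simp add: cycle_avg_def linear_scale[OF linear_R] linear_sum[OF linear_R])
  then show ?thesis
    by (simp only: sum_funpow_shift cycle_avg_def)
qed

lemma A_R: "A (R x) = A x"
proof -
  have "(R ^^ i) (R x) = (R ^^ Suc i) x" for i
    by (simp add: funpow_swap1)
  then show ?thesis
    by (simp only: cycle_avg_def sum_funpow_shift)
qed

lemma funpow_fixed: "R x = x \<Longrightarrow> (R ^^ i) x = x"
  by (induction i) simp_all

lemma A_A: "A (A x) = A x"
  using m_pos by (simp add: cycle_avg_def[of m R "A x"] funpow_fixed[OF R_A] sum_constant_scaleR)

lemma S_in_Y: "S x \<in> Y"
  by (simp add: cycle_Y_def cycle_S_def linear_diff[OF linear_A] A_R)

lemma diff_A_in_Y: "x - A x \<in> Y"
  by (simp add: cycle_Y_def linear_diff[OF linear_A] A_A)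

lemma diff_in_Y: "x \<in> Y \<Longrightarrow> y \<in> Y \<Longrightarrow> x - y \<in> Y"
  by (simp add: cycle_Y_def linear_diff[OF linear_A])

lemma closed_Y: "closed Y"
proof -
  have "closed (A -` {0})"
    by (intro closed_vimage linear_continuous_on bounded_linear_A) simp
  moreover have "A -` {0} = Y"
    by (auto simp: cycle_Y_def)
  ultimately show ?thesis
    by simp
qed

text \<open>Since \<open>R\<close> fixes \<open>A x\<close> and preserves inner products,
  \<open>A x\<close> has the same inner product with every \<open>(R ^^ i) y\<close>, hence also
  with their average \<open>A y\<close>, which vanishes.\<close>

lemma inner_A_Y:
  assumes "y \<in> Y"
  shows "inner (A x) y = 0"
proof -
  have "inner (A x) ((R ^^ i) y) = inner (A x) y" for i
    by (induction i) (simp, metis R_A inner_R funpow.simps(2) o_apply)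
  then have "inner (A x) (A y) = inner (A x) y"
    using m_pos by (simp add: cycle_avg_def[of m R y] inner_sum_right)
  then show ?thesis
    using assms by (simp add: cycle_Y_def)
qed

lemma inner_S_self: "inner (S x) x = - (1/2) * (norm (S x))\<^sup>2"
proof -
  have "inner (R x) (R x) = inner x x"
    by (rule inner_R)
  then show ?thesis
    by (simp add: cycle_S_def power2_norm_eq_inner inner_diff inner_commute field_simps)
qed

text \<open>On \<open>Y\<close> the powers \<open>(R ^^ i) y\<close> average to 0, so
  \<open>y\<close> is the average of the differences \<open>y - (R ^^ i) y\<close>. Each of these
  splits into \<open>i \<le> m\<close> steps of length \<open>norm (S y)\<close>.\<close>

lemma norm_le_S:
  assumes "y \<in> Y"
  shows "norm y \<le> real m * norm (S y)"
proof -
  have step: "norm (y - (R ^^ i) y) \<le> real i * norm (S y)" for i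
  proof (induction i)
    case (Suc i)
    have "norm ((R ^^ i) y - (R ^^ Suc i) y) = norm ((R ^^ i) (y - R y))"
      by (simp add: linear_diff[OF linear_funpow] funpow_swap1)
    also have "\<dots> = norm (S y)"
      by (simp add: norm_funpow cycle_S_def norm_minus_commute)
    finally show ?case
      using Suc norm_triangle_ineq[of "y - (R ^^ i) y" "(R ^^ i) y - (R ^^ Suc i) y"]
      by (simp add: algebra_simps)
  qed simp
  have "(\<Sum>i=1..m. (R ^^ i) y) = 0"
    using assms m_pos by (simp add: cycle_Y_def cycle_avg_def)
  then have "real m *\<^sub>R y = (\<Sum>i=1..m. y - (R ^^ i) y)"
    by (simp add: sum_subtractf sum_constant_scaleR)
  then have "real m * norm y = norm (\<Sum>i=1..m. y - (R ^^ i) y)"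
    by (metis abs_of_nat norm_scaleR)
  also have "\<dots> \<le> (\<Sum>i=1..m. real m * norm (S y))"
    by (intro sum_norm_le order_trans[OF step] mult_right_mono) auto
  also have "\<dots> = real m * (real m * norm (S y))"
    by simp
  finally show ?thesis
    using m_pos by simp
qed

lemma norm_half_add_R:
  assumes "y \<in> Y"
  shows "norm ((1/2) *\<^sub>R (y + R y)) \<le> sqrt (1 - 1 / (4 * (real m)\<^sup>2)) * norm y"
proof -
  have "inner (R y) (R y) = inner y y"
    by (rule inner_R)
  then have "(norm ((1/2) *\<^sub>R (y + R y)))\<^sup>2 = (norm y)\<^sup>2 - (norm (S y))\<^sup>2 / 4"
    by (simp add: cycle_S_def power2_norm_eq_inner inner_diff inner_add inner_commute field_simps)
  moreover have "(norm y)\<^sup>2 \<le> (real m)\<^sup>2 * (norm (S y))\<^sup>2"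
    using power_mono[OF norm_le_S[OF assms], of 2] by (simp add: power_mult_distrib)
  then have "(norm y)\<^sup>2 / (real m)\<^sup>2 \<le> (norm (S y))\<^sup>2"
    using m_pos by (simp add: divide_le_eq mult.commute)
  ultimately have "(norm ((1/2) *\<^sub>R (y + R y)))\<^sup>2 \<le> (1 - 1 / (4 * (real m)\<^sup>2)) * (norm y)\<^sup>2"
    by (simp add: left_diff_distrib)
  then show ?thesis
    by (metis norm_ge_zero real_le_rsqrt real_sqrt_abs abs_of_nonneg real_sqrt_mult)
qed

end

section \<open>The variational inequality via Banach's fixed point theorem\<close>

lemma variational_inequality_solution:
  fixes R :: "'a::{real_inner,complete_space} \<Rightarrow> 'a"
  assumes "periodic_isometry m R"
    and "closed K" "convex K" "K \<noteq> {}" "K \<subseteq> cycle_Y m R"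
  obtains e where "e \<in> K" "\<And>k. k \<in> K \<Longrightarrow> inner (cycle_S R e) (k - e) \<le> 0"
proof -
  interpret periodic_isometry m R by fact
  define q where "q = sqrt (1 - 1 / (4 * (real m)\<^sup>2))"
  \<comment> \<open>Makes the radicand of \<open>q\<close> nonnegative; \<open>sqrt\<close> is
    negative at negative arguments.\<close>
  have "1 \<le> 4 * (real m)\<^sup>2"
    using one_le_power[of "real m" 2] m_pos by linarith
  then have q: "0 \<le> q" "q < 1"
    using m_pos by (auto simp: q_def field_simps)
  obtain P where P: "\<And>z. P z \<in> K" "\<And>z y. y \<in> K \<Longrightarrow> inner (z - P z) (y - P z) \<le> 0"
    "\<And>z w. norm (P z - P w) \<le> norm (z - w)"
    using projection_exists_Hilbert[OF assms(2-4)] by blast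
  define F where "F x = P ((1/2) *\<^sub>R (x + R x))" for x
  have "\<exists>!e\<in>K. F e = e"
  proof (rule Banach_fix[OF _ \<open>K \<noteq> {}\<close> q])
    show "complete K"
      using \<open>closed K\<close> by (simp add: complete_eq_closed)
    show "F ` K \<subseteq> K"
      using P(1) by (auto simp: F_def)
    fix x y assume "x \<in> K" "y \<in> K"
    then have Y: "x - y \<in> Y"
      using assms(5) diff_in_Y by blast
    have "norm (F x - F y) \<le> norm ((1/2) *\<^sub>R (x + R x) - (1/2) *\<^sub>R (y + R y))"
      unfolding F_def by (rule P(3))
    also have "\<dots> = norm ((1/2) *\<^sub>R ((x - y) + R (x - y)))"
      by (simp add: linear_diff[OF linear_R] algebra_simps)
    also have "\<dots> \<le> q * norm (x - y)"
      unfolding q_def by (rule norm_half_add_R[OF Y])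
    finally show "dist (F x) (F y) \<le> q * dist x y"
      by (simp add: dist_norm)
  qed
  then obtain e where e: "e \<in> K" "F e = e"
    by blast
  have "inner (S e) (k - e) \<le> 0" if "k \<in> K" for k
  proof -
    \<comment> \<open>As \<open>e\<close> is the projection of this midpoint, the obtuse-angle
      inequality for \<open>P\<close> is half the desired one.\<close>
    have "(1/2) *\<^sub>R (e + R e) - e = (1/2) *\<^sub>R S e"
      using scaleR_half_double[of e] by (simp add: cycle_S_def algebra_simps)
    then show ?thesis
      using P(2)[OF that, of "(1/2) *\<^sub>R (e + R e)"] e(2) by (simp add: F_def)
  qed
  with e(1) show thesis
    using that by blast
qed

section \<open>From the variational inequality back to the support function\<close>

theorem lemma16:
  fixes m :: nat
    and R :: "'a::{real_inner,complete_space} \<Rightarrow> 'a"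
    and C :: "'a set"
  assumes "m \<ge> 2"
    and "linear_isometry R"
    and "R ^^ m = id"
    and "C \<noteq> {}" and "closed C" and "convex C"
  shows "\<exists>d\<in>cycle_Y m R. \<exists>e\<in>cycle_Y m R.
    (\<forall>x. support_fun C (cycle_S R e) + ereal (inner (cycle_S R x - cycle_S R e) e)
           - support_fun C (cycle_S R x) \<le> 0)
    \<and> d = cycle_S R e \<and> cycle_S R e \<in> cycle_D m R C"
proof -
  interpret periodic_isometry m R
    using assms by unfold_locales auto
  define K where "K = closure ((\<lambda>x. x - A x) ` C)"
  have lin: "linear (\<lambda>x. x - A x)"
    by (intro linear_compose_sub linear_A linear_ident)
  have "convex K"
    unfolding K_def using convex_linear_image[OF lin \<open>convex C\<close>] by (rule convex_closure)
  moreover have "K \<subseteq> Y"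
    unfolding K_def by (intro closure_minimal closed_Y) (auto simp: diff_A_in_Y)
  moreover have "closed K" "K \<noteq> {}"
    using \<open>C \<noteq> {}\<close> by (auto simp: K_def)
  ultimately obtain e where e: "e \<in> K" "\<And>k. k \<in> K \<Longrightarrow> inner (S e) (k - e) \<le> 0"
    using variational_inequality_solution[OF periodic_isometry_axioms] by blast
  have "e \<in> Y"
    using e(1) \<open>K \<subseteq> Y\<close> by blast
  have support_ge: "ereal (inner k y) \<le> support_fun C y" if "k \<in> K" "y \<in> Y" for k y
  proof (cases "support_fun C y = \<infinity>")
    case False
    obtain c where "c \<in> C"
      using \<open>C \<noteq> {}\<close> by blast
    have upper: "ereal (inner c y) \<le> support_fun C y" if "c \<in> C" for c
      unfolding support_fun_def using that by (rule SUP_upper)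
    then have "support_fun C y \<noteq> - \<infinity>"
      using \<open>c \<in> C\<close> by force
    with False obtain r where r: "support_fun C y = ereal r"
      by (cases "support_fun C y") auto
    \<comment> \<open>For \<open>y\<close> in \<open>Y\<close>, \<open>c - A c\<close> and
      \<open>c\<close> have the same inner product with \<open>y\<close>, so this closed halfspace
      contains the projected points and therefore their closure.\<close>
    have "K \<subseteq> {x. inner x y \<le> r}"
      unfolding K_def
    proof (rule closure_minimal)
      show "closed {x. inner x y \<le> r}"
        using closed_halfspace_le[of y r] by (simp add: inner_commute)
    qed (use upper r inner_A_Y[OF \<open>y \<in> Y\<close>] in \<open>auto simp: inner_diff_left\<close>)
    then show ?thesis
      using r \<open>k \<in> K\<close> by auto
  qed simp
  have "support_fun C (S e) = ereal (inner e (S e))"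
  proof (rule antisym)
    show "support_fun C (S e) \<le> ereal (inner e (S e))"
      unfolding support_fun_def
    proof (rule SUP_least)
      fix c assume "c \<in> C"
      then have "c - A c \<in> K"
        unfolding K_def by (intro subsetD[OF closure_subset] imageI)
      then have "inner (S e) (c - A c - e) \<le> 0"
        by (rule e(2))
      then show "ereal (inner c (S e)) \<le> ereal (inner e (S e))"
        using inner_A_Y[OF S_in_Y] by (simp add: inner_diff inner_commute)
    qed
  qed (rule support_ge[OF e(1) S_in_Y])
  then have support_S: "support_fun C (S e) = ereal (inner (S e) e)"
    by (simp add: inner_commute)
  \<comment> \<open>The two terms in \<open>S e\<close> cancel, leaving
    \<open>inner e (S x) \<le> support_fun C (S x)\<close>.\<close>
  have "support_fun C (S e) + ereal (inner (S x - S e) e) - support_fun C (S x) \<le> 0" for x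
    using support_ge[OF e(1) S_in_Y, of x]
    by (cases "support_fun C (S x)") (auto simp: support_S inner_diff_left inner_commute[of e])
  moreover have "S e \<in> cycle_D m R C"
    using S_in_Y by (simp add: cycle_D_def support_S inner_S_self zero_ereal_def)
  ultimately show ?thesis
    using S_in_Y \<open>e \<in> Y\<close> by blast
qed

end
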